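(* Let $n\ge2$, $d\ge1$, $r\ge3$ with $n\ge d$ and $dr\equiv0\pmod n$; write $Q=Q_n(d,r)$ and $q=\lceil n/d\rceil$. (a) If $dr=n$: (i) for $3\le r\le6$, $\mathsf{bw}(Q)=2^{n-1}$; (ii) for $r\ge7$, $\dfrac{2^{n+1}}{5-8(r-1)/r^2}\le\mathsf{bw}(Q)\le 2^{n-1}$. (b) If $dr\ge 2n$: (i) if $d\mid n$ and ($r$ is even or $n\ge 2d$), then $\dfrac{2^{n+1}r^2}{r^2+8n^2/d^2}\le\mathsf{bw}(Q)\le 2^n\min\{dr/(2n),\,2\}$; (ii) if $r$ is odd and $n=d$, then $\dfrac{2^{n+1}r^2}{r^2+8}\le\mathsf{bw}(Q)\le 2^{n-1}\min\{r,5\}$; (iii) if $n\not\equiv0\pmod d$, then $2^n\min\Big\{\dfrac{dr}{4n+2d},\dfrac{2r^2}{r^2+8q^2}\Big\}\le\mathsf{bw}(Q)\le 2^n\min\{dr/(2n),\,2\}$.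
   Context: $\mathbb{Z}_2^n=\{0,1\}^n$ with coordinatewise addition mod 2; $e_i$ is the $i$-th standard basis vector, subscripts read modulo $n$. The recursive cube of rings $Q_n(d,r)$ is the simple graph on $\mathbb{Z}_2^n\times\mathbb{Z}_r$ in which $(a,x)$ is adjacent to $(a+e_{i+dx},x)$ for $1\le i\le d$ and to $(a,x\pm1)$. A bisection of a graph $X$ is a partition $\{U,\overline U\}$ of $V(X)$ with $||U|-|\overline U||\le1$; the bisection width $\mathsf{bw}(X)$ is the minimum, over all bisections, of the number of edges with one end in $U$ and the other in $\overline U$. *)

theory Defs
  imports Complex_Main
begin

definition graph_edges :: "'a set \<Rightarrow> ('a \<Rightarrow> 'a \<Rightarrow> bool) \<Rightarrow> 'a set set" where
  "graph_edges V adj = {{u, v} | u v. u \<in> V \<and> v \<in> V \<and> u \<noteq> v \<and> adj u v}"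

definition cut_size :: "'a set \<Rightarrow> ('a \<Rightarrow> 'a \<Rightarrow> bool) \<Rightarrow> 'a set \<Rightarrow> nat" where
  "cut_size V adj U = card {e \<in> graph_edges V adj. \<exists>u v. e = {u, v} \<and> u \<in> U \<and> v \<in> V - U}"

definition is_bisection :: "'a set \<Rightarrow> 'a set \<Rightarrow> bool" where
  "is_bisection V U \<longleftrightarrow> U \<subseteq> V \<and> \<bar>int (card U) - int (card (V - U))\<bar> \<le> 1"

definition bisection_width :: "'a set \<Rightarrow> ('a \<Rightarrow> 'a \<Rightarrow> bool) \<Rightarrow> nat" where
  "bisection_width V adj = Min {cut_size V adj U | U. is_bisection V U}"

text \<open>A vector of Z_2^n is encoded as its support, a subset of {0..<n};
  coordinate k (1-based, read mod n) is stored as index (k-1) mod n.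
  Adding e_k is flipping that index (symmetric difference).
  Z_r is encoded as {0..<r}.\<close>

definition flip :: "nat set \<Rightarrow> nat \<Rightarrow> nat set" where
  "flip a j = (if j \<in> a then a - {j} else insert j a)"

definition rcr_vertices :: "nat \<Rightarrow> nat \<Rightarrow> (nat set \<times> nat) set" where
  "rcr_vertices n r = {(a, x). a \<subseteq> {0..<n} \<and> x < r}"

definition rcr_adj :: "nat \<Rightarrow> nat \<Rightarrow> nat \<Rightarrow> (nat set \<times> nat) \<Rightarrow> (nat set \<times> nat) \<Rightarrow> bool" where
  "rcr_adj n d r u v = (case u of (a, x) \<Rightarrow> case v of (b, y) \<Rightarrow>
      (y = x \<and> (\<exists>i\<in>{1..d}. b = flip a ((i + d * x - 1) mod n)))
    \<or> (b = a \<and> (y = (x + 1) mod r \<or> x = (y + 1) mod r)))"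

definition rcr_bw :: "nat \<Rightarrow> nat \<Rightarrow> nat \<Rightarrow> nat" where
  "rcr_bw n d r = bisection_width (rcr_vertices n r) (rcr_adj n d r)"

end

theory Submission
  imports Defs
begin

text \<open>
  Lower bounds: route every ordered pair of vertices along a path. If each edge lies on at most \<open>M\<close>
  of the paths, a bisection \<open>U\<close> cuts at least \<open>(2 ^ n * r)\<^sup>2 / (2 * M)\<close> edges, because every pair
  separated by \<open>U\<close> uses a cut edge. Any \<open>q\<close> consecutive layers with \<open>n \<le> d * q\<close> contain edges in all
  coordinate directions, so a path from layer \<open>x\<close> to layer \<open>x + k\<close> only has to sweep \<open>q\<close> consecutive
  layers; for \<open>k < q - 1\<close> it first walks back \<open>q - 1 - k\<close> steps. By translation invariance all ring
  edges carry the same load. When \<open>d * r = n\<close> all \<open>r\<close> layers must be swept and the longer way round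
  the ring is the better one, otherwise the shorter one is.

  Upper bounds: split by the value of one coordinate, or take half of the layers, where for odd \<open>r\<close>
  the middle layer is itself split by a coordinate.
\<close>

section \<open>Edge cuts, periodic sums and counting of subsets\<close>

text \<open>Each cut edge has one orientation leaving \<open>U\<close> and, by symmetry of
  \<open>adj\<close>, one entering it. Ordered pairs can then be summed vertex by vertex.\<close>

lemma double_cut_size:
  assumes "finite V" "U \<subseteq> V" and sym: "\<And>u v. adj u v \<Longrightarrow> adj v u"
  shows "2 * cut_size V adj U = card {(u, v) \<in> V \<times> V. adj u v \<and> (u \<in> U) \<noteq> (v \<in> U)}"
proof -
  let ?E = "{(u, v) \<in> U \<times> (V - U). adj u v}"
  let ?F = "{(u, v) \<in> (V - U) \<times> U. adj u v}"
  have fin: "finite U" "finite (V - U)"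
    using assms finite_subset by auto
  then have finE: "finite ?E" "finite ?F"
    by (auto intro: finite_subset[of _ "U \<times> (V - U)"] finite_subset[of _ "(V - U) \<times> U"])
  have "{e \<in> graph_edges V adj. \<exists>u v. e = {u, v} \<and> u \<in> U \<and> v \<in> V - U} = (\<lambda>(u, v). {u, v}) ` ?E"
    (is "?L = ?R")
  proof
    show "?L \<subseteq> ?R"
    proof
      fix e assume "e \<in> ?L"
      then obtain u v u' v' where e: "e = {u, v}" "u \<in> U" "v \<in> V - U" "e = {u', v'}" "adj u' v'"
        by (auto simp: graph_edges_def)
      then have "adj u v"
        using sym by (auto simp: doubleton_eq_iff)
      with e have "(u, v) \<in> ?E" by simp
      then show "e \<in> ?R" unfolding e(1) by (rule rev_image_eqI) simp
    qed
    show "?R \<subseteq> ?L"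
      using \<open>U \<subseteq> V\<close> by (fastforce simp: graph_edges_def)
  qed
  moreover have "inj_on (\<lambda>(u, v). {u, v}) ?E"
    by (rule inj_onI) (clarsimp simp: doubleton_eq_iff)
  ultimately have cut: "cut_size V adj U = card ?E"
    by (simp add: cut_size_def card_image)
  have "?F = prod.swap ` ?E"
    using sym by (auto simp: image_def)
  then have "card ?F = card ?E"
    by (simp only: card_image[OF inj_on_subset[OF inj_swap subset_UNIV]])
  moreover have "{(u, v) \<in> V \<times> V. adj u v \<and> (u \<in> U) \<noteq> (v \<in> U)} = ?E \<union> ?F"
    using \<open>U \<subseteq> V\<close> by auto
  moreover have "?E \<inter> ?F = {}" by auto
  ultimately show ?thesis
    using finE cut by (simp add: card_Un_disjoint)
qed

text \<open>Moving a window of length \<open>r\<close> by one step loses \<open>g t\<close> and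
  gains \<open>g (t + r)\<close>, which are equal. This supplies translation invariance around the
  ring.\<close>

lemma sum_periodic_shift:
  fixes g :: "nat \<Rightarrow> 'a::comm_monoid_add"
  assumes "\<And>x. g (x + r) = g x"
  shows "(\<Sum>x<r. g (x + t)) = (\<Sum>x<r. g x)"
proof (induction t)
  case (Suc t)
  have "(\<Sum>x<r. g (x + Suc t)) = (\<Sum>x<r. g (x + t))"
  proof (cases r)
    case (Suc r')
    have "(\<Sum>x<Suc r'. g (x + Suc t)) = (\<Sum>x<r'. g (Suc x + t)) + g (t + r)"
      using Suc by (simp add: add.commute)
    also have "\<dots> = (\<Sum>x<Suc r'. g (x + t))"
      unfolding sum.lessThan_Suc_shift assms by (simp add: add.commute)
    finally show ?thesis using Suc by simp
  qed simp
  with Suc show ?case by simp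
qed simp

lemma bij_betw_sym_diff: "T \<subseteq> A \<Longrightarrow> bij_betw (\<lambda>a. sym_diff a T) (Pow A) (Pow A)"
  by (rule bij_betw_byWitness[where f' = "\<lambda>a. sym_diff a T"]) auto

lemma bij_betw_sym_diff': "T \<subseteq> A \<Longrightarrow> bij_betw (sym_diff T) (Pow A) (Pow A)"
  by (rule bij_betw_byWitness[where f' = "sym_diff T"]) auto

lemma sym_diff_assoc: "sym_diff (sym_diff a S) T = sym_diff a (sym_diff S T)"
  by auto

lemma flip_eq_sym_diff: "flip a j = sym_diff a {j}"
  by (auto simp: flip_def)

lemma card_Pow_containing:
  assumes "finite A" "j \<in> A"
  shows "card {S \<in> Pow A. j \<in> S} = 2 ^ (card A - 1)"
proof -
  have "{S \<in> Pow A. j \<in> S} = insert j ` Pow (A - {j})"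
  proof (intro equalityI subsetI)
    fix S assume "S \<in> {S \<in> Pow A. j \<in> S}"
    then have "S = insert j (S - {j})" "S - {j} \<in> Pow (A - {j})" by auto
    then show "S \<in> insert j ` Pow (A - {j})" by blast
  qed (use assms in auto)
  moreover have "inj_on (insert j) (Pow (A - {j}))"
    by (auto simp: inj_on_def)
  ultimately show ?thesis
    using assms by (simp add: card_image card_Pow)
qed

lemma card_Pow_avoiding:
  assumes "finite A" "j \<in> A"
  shows "card {S \<in> Pow A. j \<notin> S} = 2 ^ (card A - 1)"
proof -
  have "{S \<in> Pow A. j \<notin> S} = Pow (A - {j})" by auto
  then show ?thesis using assms by (simp add: card_Pow)
qed

text \<open>Each \<open>j\<close> lies in half of the subsets. Hence cube edges later carry the
  factor \<open>2 ^ (n - 1)\<close> where ring edges carry \<open>2 ^ n\<close>.\<close>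

lemma sum_Pow_sum:
  fixes g :: "'a \<Rightarrow> nat"
  assumes "finite A"
  shows "(\<Sum>S\<in>Pow A. \<Sum>j\<in>S. g j) = 2 ^ (card A - 1) * (\<Sum>j\<in>A. g j)"
proof -
  have "(\<Sum>S\<in>Pow A. \<Sum>j\<in>S. g j) = (\<Sum>S\<in>Pow A. \<Sum>j\<in>A. of_bool (j \<in> S) * g j)"
    using assms by (intro sum.cong refl sum.mono_neutral_cong_left) auto
  also have "\<dots> = (\<Sum>j\<in>A. card {S \<in> Pow A. j \<in> S} * g j)"
    unfolding sum.swap[of _ A] sum_distrib_right[symmetric]
    using assms by (intro sum.cong refl arg_cong2[of _ _ _ _ "(*)"]) (simp add: of_bool_def sum.If_cases Int_def)
  also have "\<dots> = 2 ^ (card A - 1) * (\<Sum>j\<in>A. g j)"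
    using assms by (simp add: card_Pow_containing sum_distrib_left del: Pow_iff)
  finally show ?thesis .
qed

section \<open>Total lengths of walks around the ring\<close>

text \<open>From \<open>r\<close> to \<open>r + 2\<close> the sum grows by \<open>r + 1\<close>:
  each old distance rises by one and one new distance 1 appears. The gap between the two squares is
  \<open>4 * (r + 1)\<close>.\<close>

lemma four_sum_min_le: "4 * (\<Sum>k<r. min k (r - k)) \<le> r\<^sup>2" for r :: nat
proof (induction r rule: induct_nat_012)
  case (ge2 r)
  have "(\<Sum>k<Suc (Suc r). min k (Suc (Suc r) - k)) = (\<Sum>k<Suc r. min k (r - k) + 1)"
    unfolding sum.lessThan_Suc_shift[of _ "Suc r"]
    by (auto intro!: sum.cong)
  also have "\<dots> = (\<Sum>k<r. min k (r - k)) + (r + 1)"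
    by (simp add: sum_Suc)
  finally show ?case
    using ge2 by (simp add: power2_eq_square)
qed auto

lemma two_sum_diff_le: "2 * (\<Sum>k<r. p - k) \<le> p * (p + 1)" for p :: nat
proof (induction p arbitrary: r)
  case (Suc p)
  show ?case
  proof (cases r)
    case (Suc s)
    show ?thesis
      using Suc.IH[of s] unfolding Suc sum.lessThan_Suc_shift by simp
  qed simp
qed simp

text \<open>A displacement at distance \<open>m < q - 1\<close> costs the detour
  \<open>2 * (q - 1 - m)\<close>. Four times the distances sum to at most \<open>r ^ 2\<close>, and
  the detours to at most \<open>2 * q ^ 2\<close>.\<close>

lemma four_sum_walk_le:
  fixes q r :: nat
  assumes "0 < q"
  shows "4 * (\<Sum>k<r. min k (r - k) + 2 * (q - 1 - min k (r - k))) \<le> r\<^sup>2 + 8 * q\<^sup>2"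
proof -
  obtain p where q: "q = Suc p" using assms gr0_conv_Suc by blast
  \<comment> \<open>The left term is the larger of \<open>p - k\<close> and
    \<open>p - (r - k)\<close>, hence at most their sum. Writing \<open>r - k\<close> as
    \<open>Suc (r - Suc k)\<close> allows the second sum to be reversed.\<close>
  have "(\<Sum>k<r. p - min k (r - k)) \<le> (\<Sum>k<r. (p - k) + (p - Suc (r - Suc k)))"
    by (intro sum_mono) auto
  also have "\<dots> = (\<Sum>k<r. p - k) + (\<Sum>k<r. p - Suc k)"
    by (simp only: sum.distrib sum.nat_diff_reindex[of "\<lambda>k. p - Suc k"])
  also have "\<dots> \<le> 2 * (\<Sum>k<r. p - k)"
    unfolding mult_2 by (intro add_mono sum_mono) auto
  also have "\<dots> \<le> q\<^sup>2"
    using two_sum_diff_le[of p r] by (simp add: q power2_eq_square)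
  finally show ?thesis
    using four_sum_min_le[of r] by (simp add: q sum.distrib sum_distrib_left[symmetric])
qed

text \<open>This is the case \<open>q = r\<close> with the longer arc chosen. The term
  \<open>8 * r\<close> stands on the left to avoid truncated subtraction.\<close>

lemma four_sum_full_walk_le:
  fixes r :: nat
  assumes "3 \<le> r"
  shows "4 * (\<Sum>k<r. max k (r - k) + 2 * (r - 1 - max k (r - k))) + 8 * r \<le> 5 * r\<^sup>2 + 8"
proof -
  \<comment> \<open>The two arcs add up to \<open>r\<close>. At \<open>k = 0\<close> the longer arc
    is all of \<open>r\<close>, so \<open>r - 1 - r\<close> truncates to 0, which accounts for the
    extra 2.\<close>
  have "max k (r - k) + 2 * (r - 1 - max k (r - k)) = (r - 2) + min k (r - k) + of_bool (k = 0) * 2"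
    if "k < r" for k
    using that assms by (auto simp: max_def min_def)
  then have "(\<Sum>k<r. max k (r - k) + 2 * (r - 1 - max k (r - k)))
      = (\<Sum>k<r. (r - 2) + min k (r - k) + of_bool (k = 0) * 2)"
    by (intro sum.cong) auto
  also have "\<dots> = r * (r - 2) + (\<Sum>k<r. min k (r - k)) + 2"
    using assms unfolding sum.distrib sum_distrib_right[symmetric] by (simp add: of_bool_def)
  finally have *: "(\<Sum>k<r. max k (r - k) + 2 * (r - 1 - max k (r - k)))
      = r * (r - 2) + (\<Sum>k<r. min k (r - k)) + 2" .
  obtain s where "r = s + 2" using assms by (metis add.commute le_Suc_ex numeral_3_eq_3 numeral_2_eq_2 Suc_leD)
  then show ?thesis
    unfolding * using four_sum_min_le[of r] by (simp add: power2_eq_square algebra_simps)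
qed

section \<open>Coordinate directions, separated pairs and the triangle inequality\<close>

locale rcr =
  fixes n d r :: nat
  assumes n_ge: "2 \<le> n" and d_ge: "1 \<le> d" and r_ge: "3 \<le> r" and d_le: "d \<le> n"
    and dvd: "n dvd d * r"
begin

abbreviation P :: "nat set set" where "P \<equiv> Pow {0..<n}"

text \<open>\<open>dirs x\<close> are the coordinates flipped by the cube edges in layer \<open>x\<close>.  Layers \<open>x\<close> are arbitrary
  naturals, read modulo \<open>r\<close>.  \<open>diff U x S y\<close> counts the vectors \<open>a\<close> for which \<open>(a, x)\<close> and \<open>(a + S, y)\<close>
  lie on different sides of \<open>U\<close>; summing over all \<open>a\<close> makes it satisfy a triangle inequality.\<close>

definition dirs :: "nat \<Rightarrow> nat set" where
  "dirs x = (\<lambda>i. (i + d * x - 1) mod n) ` {1..d}"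

definition diff :: "(nat set \<times> nat) set \<Rightarrow> nat \<Rightarrow> nat set \<Rightarrow> nat \<Rightarrow> nat" where
  "diff U x S y = (\<Sum>a\<in>P. of_bool (((a, x mod r) \<in> U) \<noteq> ((sym_diff a S, y mod r) \<in> U)))"

lemma dirs_altdef: "dirs x = (\<lambda>i. (i + d * x) mod n) ` {..<d}"
proof -
  have "{1..d} = Suc ` {..<d}"
    by (simp add: image_Suc_lessThan)
  then show ?thesis
    by (simp add: dirs_def image_image)
qed

lemma dirs_subset: "dirs x \<subseteq> {0..<n}"
  using n_ge by (auto simp: dirs_def)

lemma finite_dirs [simp]: "finite (dirs x)"
  by (simp add: dirs_def)

text \<open>By \<open>dvd\<close>, one full turn around the ring shifts the coordinate indices by a
  multiple of \<open>n\<close>.\<close>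

lemma dirs_mod: "dirs (x mod r) = dirs x"
proof -
  have "d * x = d * r * (x div r) + d * (x mod r)"
    by (metis distrib_left mult.assoc mult_div_mod_eq)
  then have "(i + d * x) mod n = (i + d * (x mod r)) mod n" for i
  proof -
    from dvd obtain m where "d * r = n * m" ..
    then have "i + d * x = (i + d * (x mod r)) + n * (m * (x div r))"
      using \<open>d * x = _\<close> by simp
    then show ?thesis by (metis mod_mult_self2)
  qed
  then show ?thesis by (simp add: dirs_altdef)
qed

lemma dirs_add: "dirs (x + r) = dirs x"
  by (metis dirs_mod mod_add_self2)

lemma diff_add [simp]: "diff U (x + r) S y = diff U x S y" "diff U x S (y + r) = diff U x S y"
  by (simp_all add: diff_def)

lemma diff_commute:
  assumes "S \<subseteq> {0..<n}"
  shows "diff U x S y = diff U y S x"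
proof -
  have "diff U y S x = (\<Sum>a\<in>P. of_bool (((sym_diff a S, y mod r) \<in> U)
      \<noteq> ((sym_diff (sym_diff a S) S, x mod r) \<in> U)))"
    unfolding diff_def by (rule sum.reindex_bij_betw[OF bij_betw_sym_diff[OF assms], symmetric])
  also have "\<dots> = diff U x S y"
    unfolding diff_def sym_diff_assoc by (intro sum.cong) auto
  finally show ?thesis ..
qed

text \<open>Translating by \<open>S\<close> makes the second leg start where the first ends.
  Endpoints on different sides are then separated along at least one leg.\<close>

lemma diff_triangle:
  assumes "S \<subseteq> {0..<n}"
  shows "diff U x (sym_diff S T) z \<le> diff U x S y + diff U y T z"
proof -
  have "diff U y T z = (\<Sum>a\<in>P. of_bool (((sym_diff a S, y mod r) \<in> U)
      \<noteq> ((sym_diff (sym_diff a S) T, z mod r) \<in> U)))"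
    unfolding diff_def by (rule sum.reindex_bij_betw[OF bij_betw_sym_diff[OF assms], symmetric])
  then show ?thesis
    unfolding diff_def[of U x] sym_diff_assoc
    by (simp only: sum.distrib[symmetric]) (intro sum_mono, simp)
qed

lemma diff_triangle_Un:
  assumes "S \<subseteq> {0..<n}" "S \<inter> T = {}"
  shows "diff U x (S \<union> T) z \<le> diff U x S y + diff U y T z"
proof -
  have "sym_diff S T = S \<union> T" using assms(2) by auto
  then show ?thesis using diff_triangle[OF assms(1), of U x T z y] by simp
qed

lemma diff_layer_le:
  assumes "S \<subseteq> {0..<n}"
  shows "diff U x S x \<le> (\<Sum>j\<in>S. diff U x {j} x)"
proof -
  have "finite S" using assms finite_subset by auto
  then show ?thesis using assms
  proof (induction S)
    case (insert j S)
    then show ?case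
      using diff_triangle_Un[of "{j}" S U x x x] by simp
  qed (simp add: diff_def)
qed

text \<open>\<open>\<tau> j\<close> is the number of steps after which coordinate \<open>j\<close>
  is flipped. The induction peels off the last ring step together with the flips made after
  it.\<close>

lemma diff_walk_le:
  assumes "S \<subseteq> {0..<n}" "\<And>j. j \<in> S \<Longrightarrow> \<tau> j \<le> m"
  shows "diff U x S (x + m) \<le> (\<Sum>i<m. diff U (x + i) {} (Suc (x + i)))
    + (\<Sum>j\<in>S. diff U (x + \<tau> j) {j} (x + \<tau> j))"
  using assms
proof (induction m arbitrary: S)
  case 0
  then show ?case using diff_layer_le[of S U x] by simp
next
  case (Suc m)
  define S1 where "S1 = {j \<in> S. \<tau> j \<le> m}"
  define S2 where "S2 = {j \<in> S. \<tau> j = Suc m}"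
  have S: "S = S1 \<union> S2" "S1 \<inter> S2 = {}" "S1 \<subseteq> {0..<n}" "S2 \<subseteq> {0..<n}" "finite S"
    using Suc.prems finite_subset[of S "{0..<n}"] by (auto simp: S1_def S2_def le_Suc_eq)
  have "diff U x S (x + Suc m) \<le> diff U x S1 (x + m) + diff U (x + m) S2 (x + Suc m)"
    unfolding S(1) using S by (intro diff_triangle_Un)
  moreover have "diff U (x + m) S2 (x + Suc m)
      \<le> diff U (x + m) {} (x + Suc m) + diff U (x + Suc m) S2 (x + Suc m)"
    using diff_triangle_Un[of "{}" S2 U "x + m" "x + Suc m" "x + Suc m"] by simp
  moreover have "diff U (x + Suc m) S2 (x + Suc m) \<le> (\<Sum>j\<in>S2. diff U (x + \<tau> j) {j} (x + \<tau> j))"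
    using diff_layer_le[OF S(4), of U "x + Suc m"] by (simp add: S2_def)
  moreover have "diff U x S1 (x + m) \<le> (\<Sum>i<m. diff U (x + i) {} (Suc (x + i)))
      + (\<Sum>j\<in>S1. diff U (x + \<tau> j) {j} (x + \<tau> j))"
    using S by (intro Suc.IH) (auto simp: S1_def)
  moreover have "(\<Sum>j\<in>S. diff U (x + \<tau> j) {j} (x + \<tau> j))
     = (\<Sum>j\<in>S1. diff U (x + \<tau> j) {j} (x + \<tau> j)) + (\<Sum>j\<in>S2. diff U (x + \<tau> j) {j} (x + \<tau> j))"
    using S(2,5) unfolding S(1) by (intro sum.union_disjoint) auto
  ultimately show ?case by simp
qed

section \<open>Cut edges of both kinds and the load of the routes\<close>

text \<open>Summing over all vectors meets each cube edge from both ends, so this is twice the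
  number of cut cube edges; \<open>ring_cut\<close> meets each ring edge once.\<close>

definition cube_cut :: "(nat set \<times> nat) set \<Rightarrow> nat" where
  "cube_cut U = (\<Sum>x<r. \<Sum>j\<in>dirs x. diff U x {j} x)"

definition ring_cut :: "(nat set \<times> nat) set \<Rightarrow> nat" where
  "ring_cut U = (\<Sum>x<r. diff U x {} (Suc x))"

lemma ring_cut_shift: "(\<Sum>x<r. diff U (x + t) {} (Suc (x + t))) = ring_cut U"
  unfolding ring_cut_def
  by (rule sum_periodic_shift[where g = "\<lambda>x. diff U x {} (Suc x)"])
     (metis add_Suc diff_add)

lemma cube_cut_shift: "(\<Sum>x<r. \<Sum>j\<in>dirs (x + t). diff U (x + t) {j} (x + t)) = cube_cut U"
  unfolding cube_cut_def
  by (rule sum_periodic_shift[where g = "\<lambda>x. \<Sum>j\<in>dirs x. diff U x {j} x"]) (simp add: dirs_add)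

text \<open>The window offers the \<open>d * q\<close> consecutive residues starting at
  \<open>d * x\<close>, and these exhaust all residues modulo \<open>n\<close>.\<close>

lemma window_covers:
  assumes "n \<le> d * q" "j < n"
  shows "\<exists>t<q. j \<in> dirs (x + t)"
proof -
  have n0: "0 < n" using n_ge by simp
  \<comment> \<open>\<open>m\<close> is the residue of \<open>j - d * x\<close>, with
    \<open>n\<close> added against truncation. Its quotient by \<open>d\<close> selects the layer,
    its remainder the place within it.\<close>
  define m where "m = (j + (n - d * x mod n)) mod n"
  have m: "m < n" using n0 by (simp add: m_def)
  have "(m + d * x) mod n = (j + (n - d * x mod n) + d * x mod n) mod n"
    by (simp add: m_def mod_simps)
  also have "\<dots> = (j + n) mod n"
  proof -
    have "d * x mod n \<le> n" using n0 by (simp add: less_imp_le)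
    then show ?thesis by simp
  qed
  finally have mj: "(m + d * x) mod n = j"
    using assms by simp
  have "m div d < q"
    using m assms d_ge by (metis less_le_trans less_mult_imp_div_less mult.commute)
  moreover have "m mod d + d * (x + m div d) = m + d * x"
    using mod_mult_div_eq[of m d] by (simp add: distrib_left)
  then have "j = (m mod d + d * (x + m div d)) mod n"
    using mj by simp
  then have "j \<in> dirs (x + m div d)"
    using d_ge unfolding dirs_altdef by (intro image_eqI[where x = "m mod d"]) auto
  ultimately show ?thesis by blast
qed

text \<open>Since \<open>S\<close> ranges over all translations, this counts the ordered pairs
  separated by \<open>U\<close> whose second layer is \<open>k\<close> steps ahead of the
  first.\<close>

definition total :: "(nat set \<times> nat) set \<Rightarrow> nat \<Rightarrow> nat" where
  "total U k = (\<Sum>x<r. \<Sum>S\<in>P. diff U x S (x + k))"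

lemma total_shift: "(\<Sum>x<r. \<Sum>S\<in>P. diff U (x + t) S (x + t + k)) = total U k"
  unfolding total_def
proof (rule sum_periodic_shift[where g = "\<lambda>x. \<Sum>S\<in>P. diff U x S (x + k)"])
  show "(\<Sum>S\<in>P. diff U (x + r) S (x + r + k)) = (\<Sum>S\<in>P. diff U x S (x + k))" for x
  proof -
    have "x + r + k = x + k + r" by simp
    then show ?thesis by (simp only: diff_add)
  qed
qed

text \<open>Swapping the two vertices of a pair preserves separation and exchanges the two arcs
  between their layers.\<close>

lemma total_reflect:
  assumes "k \<le> r"
  shows "total U (r - k) = total U k"
proof -
  have "total U (r - k) = (\<Sum>x<r. \<Sum>S\<in>P. diff U (x + k) S (x + k + (r - k)))"
    by (rule total_shift[symmetric])
  also have "\<dots> = total U k"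
    using assms unfolding total_def by (intro sum.cong refl) (auto intro: diff_commute)
  finally show ?thesis .
qed

lemma card_P: "card P = 2 ^ n"
  by (simp add: card_Pow)

text \<open>The route to displacement \<open>k\<close> first walks back \<open>e\<close> steps and then forward \<open>k + e\<close> steps,
  flipping every coordinate inside the first \<open>q\<close> layers of the forward part.\<close>

lemma total_le:
  assumes "n \<le> d * q" "q \<le> k + e + 1"
  shows "total U k \<le> 2 ^ n * (k + 2 * e) * ring_cut U + 2 ^ (n - 1) * q * cube_cut U"
proof -
  \<comment> \<open>The layer for a coordinate is fixed independently of the target
    \<open>S\<close>, so that \<open>sum_Pow_sum\<close> applies.\<close>
  define \<tau> where "\<tau> x j = (SOME t. t < q \<and> j \<in> dirs (x + t))" for x j
  have \<tau>: "\<tau> x j < q \<and> j \<in> dirs (x + \<tau> x j)" if "j < n" for x j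
    unfolding \<tau>_def by (rule someI_ex) (rule window_covers[OF assms(1) that])
  let ?ring = "\<lambda>x m. \<Sum>i<m. diff U (x + i) {} (Suc (x + i))"
  let ?cube = "\<lambda>x j. diff U (x + \<tau> x j) {j} (x + \<tau> x j)"
  have ring: "(\<Sum>x<r. ?ring x m) = m * ring_cut U" for m
    unfolding sum.swap[of _ "{..<m}"] by (simp add: ring_cut_shift)
  have route: "diff U (x + e) S (x + e + k) \<le> ?ring x e + ?ring x (e + k) + (\<Sum>j\<in>S. ?cube x j)"
    if "S \<subseteq> {0..<n}" for x S
  proof -
    have "diff U (x + e) S (x + e + k) \<le> diff U (x + e) {} x + diff U x S (x + e + k)"
      using diff_triangle_Un[of "{}" S U "x + e" "x + e + k" x] by simp
    moreover have "diff U (x + e) {} x \<le> ?ring x e"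
      using diff_walk_le[of "{}" "\<lambda>_. 0" e U x] diff_commute[of "{}" U x "x + e"] by simp
    moreover have "\<tau> x j \<le> e + k" if "j \<in> S" for j
      using \<tau>[of j x] that \<open>S \<subseteq> {0..<n}\<close> assms(2) by auto
    then have "diff U x S (x + e + k) \<le> ?ring x (e + k) + (\<Sum>j\<in>S. ?cube x j)"
      using diff_walk_le[OF that, of "\<tau> x" "e + k" U x] by (simp only: add.assoc)
    ultimately show ?thesis by linarith
  qed
  \<comment> \<open>The pairs \<open>(\<tau> x j, j)\<close> are distinct for distinct
    \<open>j\<close>, so they pick distinct terms of the full sum over the window.\<close>
  have cube: "(\<Sum>j\<in>{0..<n}. ?cube x j) \<le> (\<Sum>t<q. \<Sum>j\<in>dirs (x + t). diff U (x + t) {j} (x + t))" for x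
  proof -
    have "(\<Sum>j\<in>{0..<n}. ?cube x j)
        = (\<Sum>p\<in>(\<lambda>j. (\<tau> x j, j)) ` {0..<n}. diff U (x + fst p) {snd p} (x + fst p))"
      by (subst sum.reindex) (auto simp: inj_on_def)
    also have "\<dots> \<le> (\<Sum>p\<in>(SIGMA t:{..<q}. dirs (x + t)). diff U (x + fst p) {snd p} (x + fst p))"
      using \<tau> by (intro sum_mono2) auto
    also have "\<dots> = (\<Sum>t<q. \<Sum>j\<in>dirs (x + t). diff U (x + t) {j} (x + t))"
      by (subst sum.Sigma) (auto simp: case_prod_beta)
    finally show ?thesis .
  qed
  have "total U k = (\<Sum>x<r. \<Sum>S\<in>P. diff U (x + e) S (x + e + k))"
    by (rule total_shift[symmetric])
  also have "\<dots> \<le> (\<Sum>x<r. \<Sum>S\<in>P. ?ring x e + ?ring x (e + k) + (\<Sum>j\<in>S. ?cube x j))"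
    using route by (intro sum_mono) auto
  also have "\<dots> = (\<Sum>x<r. 2 ^ n * (?ring x e + ?ring x (e + k)) + 2 ^ (n - 1) * (\<Sum>j\<in>{0..<n}. ?cube x j))"
    by (simp add: sum.distrib sum_Pow_sum card_P distrib_left)
  also have "\<dots> \<le> (\<Sum>x<r. 2 ^ n * (?ring x e + ?ring x (e + k))
      + 2 ^ (n - 1) * (\<Sum>t<q. \<Sum>j\<in>dirs (x + t). diff U (x + t) {j} (x + t)))"
    using cube by (intro sum_mono add_mono mult_left_mono) auto
  also have "\<dots> = 2 ^ n * (e * ring_cut U + (e + k) * ring_cut U) + 2 ^ (n - 1) * (q * cube_cut U)"
    unfolding sum.distrib sum_distrib_left[symmetric] ring sum.swap[of _ "{..<q}"]
    by (simp add: cube_cut_shift)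
  finally show ?thesis by (simp add: algebra_simps)
qed

section \<open>The cut size of the graph and its bound from the routes\<close>

abbreviation V :: "(nat set \<times> nat) set" where "V \<equiv> rcr_vertices n r"

abbreviation cut :: "(nat set \<times> nat) set \<Rightarrow> nat" where
  "cut U \<equiv> cut_size V (rcr_adj n d r) U"

lemma vertices_eq: "V = P \<times> {..<r}"
  by (auto simp: rcr_vertices_def)

lemma finite_vertices: "finite V"
  by (simp add: vertices_eq)

lemma card_vertices: "card V = 2 ^ n * r"
  by (simp add: vertices_eq card_cartesian_product card_P)

lemma two_power_n: "2 ^ n = 2 * (2 ^ (n - 1) :: nat)"
  using n_ge by (cases n) auto

text \<open>The start \<open>(a, x)\<close> together with \<open>S\<close> and \<open>k\<close>
  determines the target, and every ordered pair of vertices arises exactly once.\<close>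

lemma sum_total:
  assumes "U \<subseteq> V"
  shows "(\<Sum>k<r. total U k) = 2 * card U * card (V - U)"
proof -
  have "(\<Sum>k<r. total U k) = (\<Sum>x<r. \<Sum>S\<in>P. \<Sum>k<r. diff U x S (k + x))"
    unfolding total_def
    by (subst sum.swap) (intro sum.cong refl, subst sum.swap, simp add: add.commute)
  also have "\<dots> = (\<Sum>x<r. \<Sum>S\<in>P. \<Sum>y<r. diff U x S y)"
    by (intro sum.cong refl sum_periodic_shift diff_add)
  also have "\<dots> = (\<Sum>x<r. \<Sum>S\<in>P. \<Sum>y<r. \<Sum>a\<in>P. of_bool (((a, x) \<in> U) \<noteq> ((sym_diff a S, y) \<in> U)))"
    by (intro sum.cong refl) (simp add: diff_def)
  also have "\<dots> = (\<Sum>x<r. \<Sum>a\<in>P. \<Sum>S\<in>P. \<Sum>y<r. of_bool (((a, x) \<in> U) \<noteq> ((sym_diff a S, y) \<in> U)))"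
    unfolding sum.swap[of _ P "{..<r}"] by (intro sum.cong refl sum.swap)
  also have "\<dots> = (\<Sum>x<r. \<Sum>a\<in>P. \<Sum>b\<in>P. \<Sum>y<r. of_bool (((a, x) \<in> U) \<noteq> ((b, y) \<in> U)))"
    by (intro sum.cong refl sum.reindex_bij_betw[OF bij_betw_sym_diff'
          , where g = "\<lambda>b. \<Sum>y<r. of_bool (((_, _) \<in> U) \<noteq> ((b, y) \<in> U))"]) auto
  also have "\<dots> = (\<Sum>u\<in>V. \<Sum>v\<in>V. of_bool ((u \<in> U) \<noteq> (v \<in> U)))"
  proof -
    have "(\<Sum>u\<in>V. \<Sum>v\<in>V. F u v) = (\<Sum>x<r. \<Sum>a\<in>P. \<Sum>b\<in>P. \<Sum>y<r. F (a, x) (b, y))"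
      for F :: "nat set \<times> nat \<Rightarrow> nat set \<times> nat \<Rightarrow> nat"
    proof -
      have "(\<Sum>u\<in>V. \<Sum>v\<in>V. F u v) = (\<Sum>a\<in>P. \<Sum>x<r. \<Sum>v\<in>V. F (a, x) v)"
        unfolding vertices_eq by (subst sum.cartesian_product) (simp add: case_prod_beta)
      also have "\<dots> = (\<Sum>x<r. \<Sum>a\<in>P. \<Sum>v\<in>V. F (a, x) v)"
        by (rule sum.swap)
      also have "\<dots> = (\<Sum>x<r. \<Sum>a\<in>P. \<Sum>b\<in>P. \<Sum>y<r. F (a, x) (b, y))"
        unfolding vertices_eq by (subst sum.cartesian_product) (simp add: case_prod_beta)
      finally show ?thesis .
    qed
    then show ?thesis by simp
  qed
  also have "\<dots> = (\<Sum>u\<in>V. if u \<in> U then card (V - U) else card U)"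
  proof (intro sum.cong refl)
    fix u
    have "(\<Sum>v\<in>V. of_bool ((u \<in> U) \<noteq> (v \<in> U))) = card {v \<in> V. (u \<in> U) \<noteq> (v \<in> U)}"
      using finite_vertices by (simp add: Int_def)
    also have "{v \<in> V. (u \<in> U) \<noteq> (v \<in> U)} = (if u \<in> U then V - U else U)"
      using assms by auto
    finally show "(\<Sum>v\<in>V. of_bool ((u \<in> U) \<noteq> (v \<in> U))) = (if u \<in> U then card (V - U) else card U)"
      by simp
  qed
  also have "\<dots> = 2 * card U * card (V - U)"
  proof -
    have "V \<inter> {u. u \<in> U} = U" "V \<inter> - {u. u \<in> U} = V - U" using assms by auto
    then show ?thesis using finite_vertices by (simp add: sum.If_cases)
  qed
  finally show ?thesis .
qed

lemma rcr_adj_sym: "rcr_adj n d r u v \<Longrightarrow> rcr_adj n d r v u"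
proof -
  have "flip (flip a j) j = a" for a j by (auto simp: flip_def)
  then show "rcr_adj n d r u v \<Longrightarrow> rcr_adj n d r v u"
    unfolding rcr_adj_def by (auto split: prod.splits)
qed

text \<open>The predecessor layer is written \<open>x + (r - 1)\<close> because \<open>x - 1\<close>
  would truncate at 0.\<close>

lemma rcr_neighbours:
  assumes "a \<in> P" "x < r"
  shows "{v \<in> V. rcr_adj n d r (a, x) v} =
    (\<lambda>j. (flip a j, x)) ` dirs x \<union> {(a, (x + 1) mod r), (a, (x + (r - 1)) mod r)}"
proof -
  have "x = (y + 1) mod r \<longleftrightarrow> y = (x + (r - 1)) mod r" if "y < r" for y
  proof
    assume "x = (y + 1) mod r"
    then have "(x + (r - 1)) mod r = (y + 1 + (r - 1)) mod r"
      by (simp add: mod_add_left_eq)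
    then show "y = (x + (r - 1)) mod r" using that by simp
  next
    assume "y = (x + (r - 1)) mod r"
    then have "(y + 1) mod r = (x + (r - 1) + 1) mod r"
      by (metis mod_add_left_eq)
    then show "x = (y + 1) mod r" using assms by simp
  qed
  moreover have "flip a j \<subseteq> {0..<n}" if "j \<in> dirs x" for j
    using that assms dirs_subset[of x] by (auto simp: flip_def)
  moreover have "(\<exists>i\<in>{1..d}. b = flip a ((i + d * x - 1) mod n)) \<longleftrightarrow> b \<in> flip a ` dirs x" for b
    by (auto simp: dirs_def)
  ultimately show ?thesis
    using assms r_ge by (fastforce simp: rcr_adj_def rcr_vertices_def)
qed

lemma double_cut:
  assumes "U \<subseteq> V"
  shows "2 * cut U = cube_cut U + 2 * ring_cut U"
proof -
  let ?d = "\<lambda>u v. of_bool ((u \<in> U) \<noteq> (v \<in> U)) :: nat"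
  have neighbours: "card {v \<in> V. rcr_adj n d r (a, x) v \<and> ((a, x) \<in> U) \<noteq> (v \<in> U)}
     = (\<Sum>j\<in>dirs x. ?d (a, x) (sym_diff a {j}, x)) + ?d (a, x) (a, (x + 1) mod r)
       + ?d (a, x) (a, (x + (r - 1)) mod r)" if "a \<in> P" "x < r" for a x
  proof -
    let ?A = "(\<lambda>j. (flip a j, x)) ` dirs x"
    \<comment> \<open>The two ring neighbours are distinct because \<open>r\<close> is at least
      3.\<close>
    have ne: "(x + 1) mod r \<noteq> (x + (r - 1)) mod r"
    proof
      assume "(x + 1) mod r = (x + (r - 1)) mod r"
      then have "(x + 1 + 1) mod r = (x + (r - 1) + 1) mod r"
        by (metis mod_add_left_eq)
      then have "(x + 2) mod r = x"
        using that r_ge by simp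
      then show False
        using that r_ge by (cases "x + 2 < r") (auto simp: le_mod_geq not_less)
    qed
    have flip: "flip a j \<noteq> a" for j by (auto simp: flip_def)
    have inj: "inj_on (\<lambda>j. (flip a j, x)) (dirs x)"
      by (rule inj_onI) (auto simp: flip_def split: if_splits)
    have "card {v \<in> V. rcr_adj n d r (a, x) v \<and> ((a, x) \<in> U) \<noteq> (v \<in> U)}
        = card {v \<in> {v \<in> V. rcr_adj n d r (a, x) v}. ((a, x) \<in> U) \<noteq> (v \<in> U)}"
      by (rule arg_cong[where f = card]) auto
    also have "\<dots> = (\<Sum>v\<in>{v \<in> V. rcr_adj n d r (a, x) v}. ?d (a, x) v)"
      using finite_vertices by (simp add: Int_def)
    also have "\<dots> = (\<Sum>v\<in>?A. ?d (a, x) v)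
        + (\<Sum>v\<in>{(a, (x + 1) mod r), (a, (x + (r - 1)) mod r)}. ?d (a, x) v)"
      unfolding rcr_neighbours[OF that] using flip by (intro sum.union_disjoint) fastforce+
    also have "(\<Sum>v\<in>?A. ?d (a, x) v) = (\<Sum>j\<in>dirs x. ?d (a, x) (sym_diff a {j}, x))"
      unfolding flip_eq_sym_diff[symmetric] by (rule sum.reindex_cong[OF inj]) auto
    also have "(\<Sum>v\<in>{(a, (x + 1) mod r), (a, (x + (r - 1)) mod r)}. ?d (a, x) v)
        = ?d (a, x) (a, (x + 1) mod r) + ?d (a, x) (a, (x + (r - 1)) mod r)"
      using ne by simp
    finally show ?thesis by simp
  qed
  \<comment> \<open>A backward ring step is a forward one seen from its other end.\<close>
  have ring_back: "(\<Sum>x<r. diff U x {} (x + (r - 1))) = ring_cut U"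
  proof -
    have per: "diff U (x + r) {} (x + r + (r - 1)) = diff U x {} (x + (r - 1))" for x
    proof -
      have "x + r + (r - 1) = x + (r - 1) + r" by simp
      then show ?thesis by (simp only: diff_add)
    qed
    have "(\<Sum>x<r. diff U x {} (x + (r - 1))) = (\<Sum>x<r. diff U (x + 1) {} (x + 1 + (r - 1)))"
      by (rule sum_periodic_shift[symmetric, where g = "\<lambda>x. diff U x {} (x + (r - 1))", OF per])
    also have "\<dots> = ring_cut U"
      unfolding ring_cut_def using r_ge by (intro sum.cong) (auto simp: diff_commute[of "{}"])
    finally show ?thesis .
  qed
  have "2 * cut U = card {(u, v) \<in> V \<times> V. rcr_adj n d r u v \<and> (u \<in> U) \<noteq> (v \<in> U)}"
    by (rule double_cut_size[OF finite_vertices assms rcr_adj_sym])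
  also have "\<dots> = card (SIGMA u:V. {v \<in> V. rcr_adj n d r u v \<and> (u \<in> U) \<noteq> (v \<in> U)})"
    by (rule arg_cong[where f = card]) auto
  also have "\<dots> = (\<Sum>u\<in>V. card {v \<in> V. rcr_adj n d r u v \<and> (u \<in> U) \<noteq> (v \<in> U)})"
    using finite_vertices by (intro card_SigmaI) auto
  also have "\<dots> = (\<Sum>a\<in>P. \<Sum>x<r. card {v \<in> V. rcr_adj n d r (a, x) v \<and> ((a, x) \<in> U) \<noteq> (v \<in> U)})"
    unfolding vertices_eq by (simp add: sum.cartesian_product case_prod_beta)
  also have "\<dots> = (\<Sum>a\<in>P. \<Sum>x<r. (\<Sum>j\<in>dirs x. ?d (a, x) (sym_diff a {j}, x))
      + ?d (a, x) (a, (x + 1) mod r) + ?d (a, x) (a, (x + (r - 1)) mod r))"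
    by (intro sum.cong refl neighbours) auto
  also have "\<dots> = (\<Sum>x<r. (\<Sum>j\<in>dirs x. \<Sum>a\<in>P. ?d (a, x) (sym_diff a {j}, x))
      + (\<Sum>a\<in>P. ?d (a, x) (a, (x + 1) mod r)) + (\<Sum>a\<in>P. ?d (a, x) (a, (x + (r - 1)) mod r)))"
    unfolding sum.swap[of _ "{..<r}" P] sum.distrib sum.swap[of _ "dirs _" P] ..
  also have "\<dots> = (\<Sum>x<r. (\<Sum>j\<in>dirs x. diff U x {j} x) + diff U x {} (Suc x) + diff U x {} (x + (r - 1)))"
    by (intro sum.cong refl) (simp add: diff_def)
  also have "\<dots> = cube_cut U + 2 * ring_cut U"
    unfolding sum.distrib ring_back by (simp add: cube_cut_def ring_cut_def)
  finally show ?thesis .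
qed

text \<open>The number of vertices is even, so the two sides differ by an even number, which must be
  0.\<close>

lemma is_bisection_iff: "is_bisection V U \<longleftrightarrow> U \<subseteq> V \<and> 2 * card U = 2 ^ n * r"
proof -
  have "card U + card (V - U) = 2 * (2 ^ (n - 1) * r)" if "U \<subseteq> V"
    using that finite_vertices card_vertices two_power_n
    by (metis card_Diff_subset card_mono finite_subset le_add_diff_inverse mult.assoc)
  then show ?thesis
    unfolding is_bisection_def two_power_n by (cases "U \<subseteq> V") (simp_all, presburger)
qed

text \<open>\<open>\<kappa> k\<close> chooses the direction in which displacement \<open>k\<close> is routed around the ring. A ring edge
  is then used by \<open>2 ^ n\<close> times the total length of the chosen routes, a cube edge by at most
  \<open>2 ^ n * r * q\<close> ordered pairs.\<close>

lemma cut_lower_bound: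
  assumes U: "is_bisection V U" and q: "n \<le> d * q"
    and \<kappa>: "\<And>k. k < r \<Longrightarrow> \<kappa> k = k \<or> \<kappa> k = r - k"
    and L: "4 * (\<Sum>k<r. \<kappa> k + 2 * (q - 1 - \<kappa> k)) \<le> W" and rq: "4 * (r * q) \<le> W"
  shows "2 ^ (n + 1) * r\<^sup>2 \<le> W * cut U"
proof -
  define p where "p = (2 ^ (n - 1) :: nat)"
  define L where "L = (\<Sum>k<r. \<kappa> k + 2 * (q - 1 - \<kappa> k))"
  have p: "2 ^ n = 2 * p" "0 < p" using two_power_n by (simp_all add: p_def)
  have sub: "U \<subseteq> V" and "2 * card U = 2 * p * r"
    using U by (auto simp: is_bisection_iff p)
  moreover from this have "card (V - U) = p * r"
    using finite_vertices card_vertices by (subst card_Diff_subset) (auto intro: finite_subset simp: p)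
  ultimately have "2 * (p * r) * (p * r) = (\<Sum>k<r. total U k)"
    by (simp add: sum_total)
  also have "\<dots> = (\<Sum>k<r. total U (\<kappa> k))"
  proof (intro sum.cong refl)
    fix k assume "k \<in> {..<r}"
    then show "total U k = total U (\<kappa> k)"
      using \<kappa>[of k] total_reflect[of k U] by auto
  qed
  \<comment> \<open>The walk back is \<open>q - 1 - \<kappa> k\<close>, the least one leaving room
    for \<open>q\<close> layers.\<close>
  also have "\<dots> \<le> (\<Sum>k<r. 2 ^ n * (\<kappa> k + 2 * (q - 1 - \<kappa> k)) * ring_cut U + 2 ^ (n - 1) * q * cube_cut U)"
    by (intro sum_mono total_le q) simp
  also have "\<dots> = p * (2 * L * ring_cut U + r * q * cube_cut U)"
    by (simp add: sum.distrib sum_distrib_right[symmetric] sum_distrib_left[symmetric] p L_def)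
       (simp add: p_def algebra_simps)
  finally have "p * (2 * p * r\<^sup>2) \<le> p * (2 * L * ring_cut U + r * q * cube_cut U)"
    by (simp add: power2_eq_square algebra_simps)
  then have "2 * p * r\<^sup>2 \<le> 2 * L * ring_cut U + r * q * cube_cut U"
    using p by simp
  \<comment> \<open>The terms are grouped as in \<open>double_cut\<close>; since \<open>W\<close>
    dominates both coefficients, they combine to \<open>2 * cut U\<close>.\<close>
  then have "4 * (2 * p * r\<^sup>2) \<le> 4 * L * (2 * ring_cut U) + 4 * (r * q) * cube_cut U"
    by simp
  also have "\<dots> \<le> W * (2 * ring_cut U) + W * cube_cut U"
    using L rq by (intro add_mono mult_right_mono) (auto simp: L_def)
  also have "\<dots> = W * (2 * cut U)"
    unfolding double_cut[OF sub] by (simp add: algebra_simps)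
  finally show ?thesis by (simp add: p)
qed

section \<open>Upper bounds from explicit bisections\<close>

lemma finite_cut_sizes: "finite {cut U |U. is_bisection V U}"
proof (rule finite_subset)
  show "{cut U |U. is_bisection V U} \<subseteq> cut ` Pow V"
    by (auto simp: is_bisection_def)
qed (simp add: finite_vertices)

lemma rcr_bw_le: "is_bisection V U \<Longrightarrow> rcr_bw n d r \<le> cut U"
  unfolding rcr_bw_def bisection_width_def by (rule Min_le[OF finite_cut_sizes]) blast

lemma diff_le: "diff U x S y \<le> 2 ^ n"
proof -
  have "diff U x S y \<le> (\<Sum>a\<in>P. 1)"
    unfolding diff_def by (intro sum_mono) simp
  then show ?thesis by (simp add: card_P)
qed

lemma diff_eq_0:
  assumes "\<And>a. a \<in> P \<Longrightarrow> (a, x mod r) \<in> U \<longleftrightarrow> (sym_diff a S, y mod r) \<in> U"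
  shows "diff U x S y = 0"
  using assms unfolding diff_def by simp

definition halfcube :: "nat \<Rightarrow> nat set set" where
  "halfcube j = {a \<in> P. j \<notin> a}"

lemma card_halfcube: "j < n \<Longrightarrow> card (halfcube j) = 2 ^ (n - 1)"
  using card_Pow_avoiding[of "{0..<n}" j] by (simp add: halfcube_def)

lemma finite_halfcube: "finite (halfcube j)"
  by (simp add: halfcube_def)

text \<open>Layer \<open>x\<close> offers direction 0 only if its block of \<open>d\<close> indices
  from \<open>d * x\<close> contains a multiple \<open>n * t\<close>. The blocks are disjoint and
  stay below \<open>d * r\<close>, which bounds the possible \<open>t\<close>.\<close>

lemma card_layers_with_direction:
  "card {x \<in> {..<r}. 0 \<in> dirs x} \<le> d * r div n"
proof -
  have "{x \<in> {..<r}. 0 \<in> dirs x} \<subseteq> (\<lambda>t. n * t div d) ` {..<d * r div n}"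
  proof
    fix x assume "x \<in> {x \<in> {..<r}. 0 \<in> dirs x}"
    then obtain i where x: "x < r" "i < d" "(i + d * x) mod n = 0"
      by (auto simp: dirs_altdef)
    then obtain t where t: "i + d * x = n * t" by (auto elim: dvdE simp: mod_eq_0_iff_dvd)
    have "i + d * x < d * Suc x" using x by simp
    also have "\<dots> \<le> d * r" using x by (intro mult_left_mono) auto
    finally have "n * t < n * (d * r div n)" using dvd by (simp add: t)
    moreover have "(i + d * x) div d = x" using x by simp
    ultimately show "x \<in> (\<lambda>t. n * t div d) ` {..<d * r div n}"
      unfolding t using n_ge by (intro image_eqI[where x = t]) auto
  qed
  then have "card {x \<in> {..<r}. 0 \<in> dirs x} \<le> card ((\<lambda>t. n * t div d) ` {..<d * r div n})"
    by (intro card_mono) auto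
  also have "\<dots> \<le> d * r div n"
    using card_image_le[of "{..<d * r div n}"] by simp
  finally show ?thesis .
qed

lemma subcube_bisection: "is_bisection V (halfcube 0 \<times> {..<r})"
proof -
  have "halfcube 0 \<times> {..<r} \<subseteq> V"
    by (auto simp: vertices_eq halfcube_def)
  then show ?thesis
    using card_halfcube[of 0] n_ge two_power_n
    by (simp add: is_bisection_iff card_cartesian_product)
qed

text \<open>Splitting by coordinate 0 cuts only the \<open>2 ^ (n - 1)\<close> cube edges of
  direction 0 in each layer that offers it.\<close>

lemma rcr_bw_le_subcube: "rcr_bw n d r \<le> 2 ^ (n - 1) * (d * r div n)"
proof -
  let ?U = "halfcube 0 \<times> {..<r}"
  have "diff ?U x {j} x \<le> (if j = 0 then 2 ^ n else 0)" if "j \<in> dirs x" for x j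
    using diff_le that dirs_subset[of x]
    by (cases "j = 0") (auto intro!: diff_eq_0 simp: halfcube_def)
  then have "cube_cut ?U \<le> (\<Sum>x<r. \<Sum>j\<in>dirs x. if j = 0 then 2 ^ n else 0)"
    unfolding cube_cut_def by (intro sum_mono)
  also have "\<dots> = (\<Sum>x<r. if 0 \<in> dirs x then 2 ^ n else 0)"
    by (intro sum.cong refl) simp
  also have "\<dots> = 2 ^ n * card {x \<in> {..<r}. 0 \<in> dirs x}"
    by (simp add: sum.If_cases Int_def)
  also have "\<dots> \<le> 2 ^ n * (d * r div n)"
    using card_layers_with_direction by (intro mult_left_mono) auto
  finally have "cube_cut ?U \<le> 2 ^ n * (d * r div n)" .
  moreover have "ring_cut ?U = 0"
    unfolding ring_cut_def using r_ge by (auto intro!: diff_eq_0)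
  ultimately have "2 * cut ?U \<le> 2 * (2 ^ (n - 1) * (d * r div n))"
    using subcube_bisection double_cut[of ?U] by (simp add: is_bisection_iff two_power_n)
  then show ?thesis
    using rcr_bw_le[OF subcube_bisection] by simp
qed

text \<open>Taking the first half of the layers cuts ring edges at two seams only, each with
  \<open>2 ^ n\<close> edges.\<close>

lemma rcr_bw_le_even:
  assumes "even r"
  shows "rcr_bw n d r \<le> 2 ^ (n + 1)"
proof -
  obtain m where r: "r = 2 * m" using assms by (elim evenE)
  let ?U = "P \<times> {..<m}"
  have bis: "is_bisection V ?U"
  proof -
    have "?U \<subseteq> V" unfolding vertices_eq by (auto simp: r)
    then show ?thesis
      unfolding is_bisection_iff by (simp add: card_cartesian_product card_P r)
  qed
  have "diff ?U x {j} x = 0" if "j \<in> dirs x" for x j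
    using that dirs_subset[of x] by (intro diff_eq_0) auto
  then have "cube_cut ?U = 0" by (simp add: cube_cut_def)
  have "diff ?U x {} (Suc x) \<le> (if x = m - 1 then 2 ^ n else 0) + (if x = r - 1 then 2 ^ n else 0)"
    if "x < r" for x
  proof (cases "x = m - 1 \<or> x = r - 1")
    case True
    then have "2 ^ n \<le> (if x = m - 1 then 2 ^ n else 0) + (if x = r - 1 then 2 ^ n else (0 :: nat))"
      by auto
    then show ?thesis by (rule order_trans[OF diff_le])
  next
    case False
    then have "diff ?U x {} (Suc x) = 0"
      using that by (intro diff_eq_0) (auto simp: r)
    then show ?thesis by simp
  qed
  then have "ring_cut ?U \<le> (\<Sum>x<r. (if x = m - 1 then 2 ^ n else 0) + (if x = r - 1 then 2 ^ n else 0))"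
    unfolding ring_cut_def by (intro sum_mono) auto
  also have "\<dots> \<le> 2 ^ (n + 1)"
    by (simp add: sum.distrib)
  finally have "2 * cut ?U \<le> 2 * 2 ^ (n + 1)"
    using bis double_cut[of ?U] \<open>cube_cut ?U = 0\<close> by (simp add: is_bisection_iff)
  then show ?thesis using rcr_bw_le[OF bis] by simp
qed

text \<open>For odd \<open>r\<close> the middle layer is split by coordinate \<open>j\<close>, which costs nothing inside that layer
  if no edge there flips \<open>j\<close>.\<close>

lemma rcr_bw_le_odd:
  assumes "r = 2 * m + 1" and j: "j < n"
  shows "rcr_bw n d r \<le> 2 ^ (n + 1) + (if j \<in> dirs m then 2 ^ (n - 1) else 0)"
proof -
  define p where "p = (2 ^ (n - 1) :: nat)"
  have p: "2 ^ n = 2 * p" using two_power_n by (simp add: p_def)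
  have m: "0 < m" using r_ge assms by simp
  let ?U = "P \<times> {..<m} \<union> halfcube j \<times> {m}"
  have bis: "is_bisection V ?U"
  proof -
    have "card ?U = card (P \<times> {..<m}) + card (halfcube j \<times> {m})"
      by (rule card_Un_disjoint) (auto simp: finite_halfcube)
    also have "\<dots> = 2 * p * m + p"
      unfolding card_cartesian_product card_P card_halfcube[OF j] p by (simp add: p_def)
    finally have "2 * card ?U = 2 ^ n * r"
      unfolding p assms(1) by (simp add: algebra_simps)
    moreover have "?U \<subseteq> V"
      unfolding vertices_eq by (auto simp: assms(1) halfcube_def)
    ultimately show ?thesis unfolding is_bisection_iff by blast
  qed
  have "diff ?U x {i} x \<le> (if i = j then (if x = m then 2 * p else 0) else 0)" if "i \<in> dirs x" "x < r" for x i
  proof (cases "i = j \<and> x = m")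
    case True
    then show ?thesis using diff_le[of ?U x "{i}" x] by (simp add: p)
  next
    case False
    then have "diff ?U x {i} x = 0"
      using that dirs_subset[of x] by (intro diff_eq_0) (auto simp: halfcube_def)
    then show ?thesis by simp
  qed
  then have "cube_cut ?U \<le> (\<Sum>x<r. \<Sum>i\<in>dirs x. if i = j then (if x = m then 2 * p else 0) else 0)"
    unfolding cube_cut_def by (intro sum_mono) auto
  also have "\<dots> = (\<Sum>x<r. if x = m then (if j \<in> dirs m then 2 * p else 0) else 0)"
    by (intro sum.cong refl) auto
  also have "\<dots> = (if j \<in> dirs m then 2 * p else 0)"
    using assms by simp
  finally have cube: "cube_cut ?U \<le> (if j \<in> dirs m then 2 * p else 0)" .
  have half: "(\<Sum>a\<in>P. of_bool (j \<notin> a)) = p" "(\<Sum>a\<in>P. of_bool (j \<in> a)) = p"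
    using card_Pow_avoiding[of "{0..<n}" j] card_Pow_containing[of "{0..<n}" j] j
    by (simp_all add: Int_def p_def)
  \<comment> \<open>On either side of the middle layer only half of the vectors change sides; at the
    wrap-around seam all of them do.\<close>
  have "diff ?U x {} (Suc x) \<le>
      (if x = m - 1 then p else 0) + (if x = m then p else 0) + (if x = r - 1 then 2 * p else 0)"
    if "x < r" for x
  proof -
    consider "x = r - 1" | "x = m - 1" | "x = m" | "x \<noteq> r - 1" "x \<noteq> m - 1" "x \<noteq> m" by blast
    then show ?thesis
    proof cases
      case 1
      then show ?thesis using diff_le[of ?U x "{}" "Suc x"] by (simp add: p)
    next
      case 2
      then have "diff ?U x {} (Suc x) = (\<Sum>a\<in>P. of_bool (j \<in> a))"
        unfolding diff_def using m assms by (intro sum.cong refl) (auto simp: halfcube_def)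
      then show ?thesis using 2 half by simp
    next
      case 3
      then have "diff ?U x {} (Suc x) = (\<Sum>a\<in>P. of_bool (j \<notin> a))"
        unfolding diff_def using m assms by (intro sum.cong refl) (auto simp: halfcube_def)
      then show ?thesis using 3 half by simp
    next
      case 4
      then have "diff ?U x {} (Suc x) = 0"
        using that by (intro diff_eq_0) auto
      then show ?thesis by simp
    qed
  qed
  then have "ring_cut ?U \<le> (\<Sum>x<r. (if x = m - 1 then p else 0) + (if x = m then p else 0)
      + (if x = r - 1 then 2 * p else 0))"
    unfolding ring_cut_def by (intro sum_mono) auto
  also have "\<dots> \<le> 4 * p"
    by (simp add: sum.distrib)
  finally have "2 * cut ?U \<le> 2 * (4 * p + (if j \<in> dirs m then p else 0))"
    using bis double_cut[of ?U] cube by (simp add: is_bisection_iff split: if_splits)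
  then have "cut ?U \<le> 2 ^ (n + 1) + (if j \<in> dirs m then 2 ^ (n - 1) else 0)"
    unfolding power_add p p_def[symmetric] by (simp split: if_splits)
  then show ?thesis by (rule order_trans[OF rcr_bw_le[OF bis]])
qed

text \<open>For odd \<open>r\<close>, a layer has at most \<open>d < n\<close> directions, so the
  middle layer can be split by a coordinate that it does not flip.\<close>

lemma rcr_bw_le_layers:
  assumes "even r \<or> d < n"
  shows "rcr_bw n d r \<le> 2 ^ (n + 1)"
proof (cases "even r")
  case False
  then obtain m where r: "r = 2 * m + 1" by (elim oddE)
  have "card (dirs m) \<le> d"
    unfolding dirs_def using card_image_le[of "{1..d}"] by simp
  then have "card (dirs m) < card {0..<n}"
    using assms False by simp
  then obtain j where "j < n" "j \<notin> dirs m"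
    by (metis atLeastLessThan_iff card_mono finite_dirs not_less subsetI zero_le)
  then show ?thesis using rcr_bw_le_odd[OF r, of j] by simp
qed (rule rcr_bw_le_even)

lemma rcr_bw_le_five:
  assumes "odd r"
  shows "rcr_bw n d r \<le> 5 * 2 ^ (n - 1)"
proof -
  obtain m where r: "r = 2 * m + 1" using assms by (elim oddE)
  show ?thesis using rcr_bw_le_odd[OF r, of 0] n_ge two_power_n by (auto split: if_splits)
qed

section \<open>Lower bounds for the bisection width\<close>

lemma rcr_bw_lower_bound:
  assumes "n \<le> d * q" "\<And>k. k < r \<Longrightarrow> \<kappa> k = k \<or> \<kappa> k = r - k"
    and "4 * (\<Sum>k<r. \<kappa> k + 2 * (q - 1 - \<kappa> k)) \<le> W" "4 * (r * q) \<le> W"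
  shows "2 ^ (n + 1) * r\<^sup>2 \<le> W * rcr_bw n d r"
proof -
  \<comment> \<open>\<open>subcube_bisection\<close> shows that the set is nonempty, so the minimum
    is attained.\<close>
  have "rcr_bw n d r \<in> {cut U |U. is_bisection V U}"
    unfolding rcr_bw_def bisection_width_def
    using subcube_bisection by (intro Min_in finite_cut_sizes) blast
  then obtain U where "is_bisection V U" "rcr_bw n d r = cut U" by blast
  then show ?thesis using cut_lower_bound[OF _ assms] by simp
qed

text \<open>Every displacement takes the shorter arc. The ring load gives the coefficient, and the
  cube load \<open>4 * (r * q)\<close> stays below it.\<close>

lemma rcr_bw_lower_bound_short:
  assumes "n \<le> d * q"
  shows "2 ^ (n + 1) * r\<^sup>2 \<le> (r\<^sup>2 + 8 * q\<^sup>2) * rcr_bw n d r"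
proof (rule rcr_bw_lower_bound[OF assms, where \<kappa> = "\<lambda>k. min k (r - k)"])
  have "0 < q" using assms n_ge by (cases q) auto
  then show "4 * (\<Sum>k<r. min k (r - k) + 2 * (q - 1 - min k (r - k))) \<le> r\<^sup>2 + 8 * q\<^sup>2"
    by (rule four_sum_walk_le)
  \<comment> \<open>The square of \<open>r - 2 * q\<close> is expanded over the integers, where the
    difference does not truncate.\<close>
  have "(int r - 2 * int q)\<^sup>2 = (int r)\<^sup>2 + 4 * (int q)\<^sup>2 - 4 * (int r * int q)"
    by (simp add: power2_eq_square algebra_simps)
  then have "4 * (int r * int q) \<le> (int r)\<^sup>2 + 8 * (int q)\<^sup>2"
    using zero_le_power2[of "int r - 2 * int q"] zero_le_power2[of "int q"] by linarith
  then show "4 * (r * q) \<le> r\<^sup>2 + 8 * q\<^sup>2"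
    by (metis (mono_tags, lifting) of_nat_add of_nat_le_iff of_nat_mult of_nat_numeral of_nat_power)
qed (auto simp: min_def)

text \<open>Here all \<open>r\<close> layers must be swept, so \<open>q = r\<close>. The two bounds
  on \<open>W\<close> come from the cube load and the ring load; which one dominates depends on
  \<open>r\<close>.\<close>

lemma rcr_bw_lower_bound_full:
  assumes "d * r = n" "4 * r\<^sup>2 \<le> W" "5 * r\<^sup>2 + 8 - 8 * r \<le> W"
  shows "2 ^ (n + 1) * r\<^sup>2 \<le> W * rcr_bw n d r"
proof (rule rcr_bw_lower_bound[where q = r and \<kappa> = "\<lambda>k. max k (r - k)"])
  show "4 * (\<Sum>k<r. max k (r - k) + 2 * (r - 1 - max k (r - k))) \<le> W"
    using four_sum_full_walk_le[OF r_ge] assms by linarith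
qed (use assms in \<open>auto simp: max_def power2_eq_square\<close>)

end

section \<open>The bounds in real arithmetic\<close>

theorem mainTheorem19:
  fixes n d r :: nat
  assumes "n \<ge> 2" "d \<ge> 1" "r \<ge> 3" "n \<ge> d" "n dvd d * r"
  defines "q \<equiv> \<lceil>real n / real d\<rceil>"
  shows
   "(d * r = n \<longrightarrow>
       ((3 \<le> r \<and> r \<le> 6 \<longrightarrow> rcr_bw n d r = 2 ^ (n - 1)) \<and>
        (r \<ge> 7 \<longrightarrow>
           2 ^ (n + 1) / (5 - 8 * (real r - 1) / (real r)^2) \<le> real (rcr_bw n d r) \<and>
           real (rcr_bw n d r) \<le> 2 ^ (n - 1))))
  \<and> (d * r \<ge> 2 * n \<longrightarrow>
       ((d dvd n \<and> (even r \<or> n \<ge> 2 * d) \<longrightarrow>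
           2 ^ (n + 1) * (real r)^2 / ((real r)^2 + 8 * (real n)^2 / (real d)^2) \<le> real (rcr_bw n d r) \<and>
           real (rcr_bw n d r) \<le> 2 ^ n * min (real (d * r) / real (2 * n)) 2) \<and>
        (odd r \<and> n = d \<longrightarrow>
           2 ^ (n + 1) * (real r)^2 / ((real r)^2 + 8) \<le> real (rcr_bw n d r) \<and>
           real (rcr_bw n d r) \<le> 2 ^ (n - 1) * min (real r) 5) \<and>
        (\<not> d dvd n \<longrightarrow>
           2 ^ n * min (real (d * r) / real (4 * n + 2 * d)) (2 * (real r)^2 / ((real r)^2 + 8 * (real_of_int q)^2))
             \<le> real (rcr_bw n d r) \<and>
           real (rcr_bw n d r) \<le> 2 ^ n * min (real (d * r) / real (2 * n)) 2)))"
proof -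
  interpret rcr n d r
    using assms by unfold_locales
  let ?bw = "rcr_bw n d r"
  have subcube: "real ?bw \<le> 2 ^ n * (real (d * r) / real (2 * n))"
  proof -
    have "real ?bw \<le> 2 ^ (n - 1) * real (d * r div n)"
      using of_nat_mono[OF rcr_bw_le_subcube, where 'a = real] by simp
    also have "real (d * r div n) = real (d * r) / real n"
      using dvd by (rule real_of_nat_div)
    also have "2 ^ (n - 1) * (real (d * r) / real n) = 2 ^ n * (real (d * r) / real (2 * n))"
      using n_ge by (cases n) (simp_all add: field_simps)
    finally show ?thesis .
  qed
  have layers: "real ?bw \<le> 2 ^ n * 2" if "even r \<or> d < n"
    using of_nat_mono[OF rcr_bw_le_layers[OF that], where 'a = real] by simp
  have short: "2 ^ (n + 1) * (real r)\<^sup>2 / ((real r)\<^sup>2 + 8 * (real Q)\<^sup>2) \<le> real ?bw" if "n \<le> d * Q" for Q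
  proof -
    have "2 ^ (n + 1) * (real r)\<^sup>2 \<le> ((real r)\<^sup>2 + 8 * (real Q)\<^sup>2) * real ?bw"
      using of_nat_mono[OF rcr_bw_lower_bound_short[OF that], where 'a = real] by simp
    moreover have "0 < (real r)\<^sup>2 + 8 * (real Q)\<^sup>2"
      using r_ge by (intro add_pos_nonneg) auto
    ultimately show ?thesis by (simp add: pos_divide_le_eq mult.commute)
  qed

  have a_upper: "?bw \<le> 2 ^ (n - 1)" if "d * r = n"
    using rcr_bw_le_subcube that n_ge by simp
  have a_upper_real: "real ?bw \<le> 2 ^ (n - 1)" if "d * r = n"
    using of_nat_mono[OF a_upper[OF that], where 'a = real] by simp
  have a_small: "?bw = 2 ^ (n - 1)" if "d * r = n" "r \<le> 6"
  proof -
    \<comment> \<open>For these \<open>r\<close> the cube load \<open>4 * r ^ 2\<close> dominates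
      the ring load, and the lower bound meets \<open>a_upper\<close>.\<close>
    have "r \<in> {3, 4, 5, 6}" using that r_ge by auto
    then have "2 ^ (n + 1) * r\<^sup>2 \<le> 4 * r\<^sup>2 * ?bw"
      by (intro rcr_bw_lower_bound_full that) auto
    then have "2 ^ (n + 1) \<le> 4 * ?bw"
      using r_ge by (simp add: mult.commute mult.left_commute)
    then show ?thesis
      using a_upper that two_power_n by simp
  qed
  have a_large: "2 ^ (n + 1) / (5 - 8 * (real r - 1) / (real r)^2) \<le> real ?bw"
    if "d * r = n" "7 \<le> r"
  proof -
    \<comment> \<open>This keeps the natural subtraction exact and makes
      \<open>5 * r ^ 2 + 8 - 8 * r\<close> at least \<open>4 * r ^ 2\<close>.\<close>
    have *: "8 * r \<le> r\<^sup>2 + 8"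
    proof (cases "r = 7")
      case False
      then have "8 * r \<le> r * r" using that by (intro mult_right_mono) auto
      then show ?thesis unfolding power2_eq_square by linarith
    qed simp
    have "2 ^ (n + 1) * r\<^sup>2 \<le> (5 * r\<^sup>2 + 8 - 8 * r) * ?bw"
      using * by (intro rcr_bw_lower_bound_full that) auto
    then have "real (2 ^ (n + 1) * r\<^sup>2) \<le> real ((5 * r\<^sup>2 + 8 - 8 * r) * ?bw)"
      by (rule of_nat_mono)
    also have "\<dots> = (5 * (real r)\<^sup>2 + 8 - 8 * real r) * real ?bw"
      using * by (simp add: of_nat_diff)
    finally have ineq: "2 ^ (n + 1) * (real r)\<^sup>2 \<le> (5 * (real r)\<^sup>2 + 8 - 8 * real r) * real ?bw"
      by simp
    have "real (8 * r) \<le> real (r\<^sup>2 + 8)" using * by (rule of_nat_mono)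
    then have "0 < 5 * (real r)\<^sup>2 + 8 - 8 * real r"
      using r_ge zero_less_power2[of "real r"] by simp
    moreover have "5 - 8 * (real r - 1) / (real r)\<^sup>2 = (5 * (real r)\<^sup>2 + 8 - 8 * real r) / (real r)\<^sup>2"
      using r_ge by (simp add: field_simps)
    ultimately show ?thesis
      using ineq by (simp add: pos_divide_le_eq mult.commute)
  qed

  have q: "n \<le> d * nat q" "real_of_int q = real (nat q)"
  proof -
    have ge: "real n / real d \<le> real_of_int q" unfolding q_def by (rule le_of_int_ceiling)
    moreover have "0 \<le> real n / real d" by simp
    ultimately have "0 \<le> real_of_int q" by linarith
    then show nat_q: "real_of_int q = real (nat q)" by simp
    have "real n = real d * (real n / real d)" using d_ge by simp
    also have "\<dots> \<le> real d * real (nat q)" using ge unfolding nat_q by (rule mult_left_mono) simp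
    finally show "n \<le> d * nat q" by (simp only: of_nat_mult[symmetric] of_nat_le_iff)
  qed
  have b1: "2 ^ (n + 1) * (real r)^2 / ((real r)^2 + 8 * (real n)^2 / (real d)^2) \<le> real ?bw"
    if "d dvd n"
    using short[of "n div d"] that by (simp add: real_of_nat_div power_divide)
  have b2: "2 ^ (n + 1) * (real r)^2 / ((real r)^2 + 8) \<le> real ?bw"
    if "n = d"
    using short[of 1] that by simp
  have b2': "real ?bw \<le> 2 ^ (n - 1) * min (real r) 5" if "odd r" "n = d"
  proof -
    have "?bw \<le> 2 ^ (n - 1) * min r 5"
      using rcr_bw_le_subcube rcr_bw_le_five[OF that(1)] that n_ge by (simp add: min_def)
    then have "real ?bw \<le> real (2 ^ (n - 1) * min r 5)" by (rule of_nat_mono)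
    then show ?thesis by (simp add: of_nat_min)
  qed
  \<comment> \<open>A minimum is at most its second entry, which is the bound \<open>short\<close>
    with \<open>Q = nat q\<close>.\<close>
  have b3: "2 ^ n * min x (2 * (real r)^2 / ((real r)^2 + 8 * (real_of_int q)^2)) \<le> real ?bw" for x
  proof -
    have "2 ^ n * min x (2 * (real r)^2 / ((real r)^2 + 8 * (real_of_int q)^2))
        \<le> 2 ^ n * (2 * (real r)^2 / ((real r)^2 + 8 * (real_of_int q)^2))"
      by (intro mult_left_mono) auto
    also have "\<dots> \<le> real ?bw"
      using short[OF q(1)] unfolding q(2) by (simp add: mult.assoc mult.left_commute)
    finally show ?thesis .
  qed
  have upper: "real ?bw \<le> 2 ^ n * min (real (d * r) / real (2 * n)) 2" if "even r \<or> d < n"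
    using subcube layers[OF that] by (simp add: min_def)
  have ge2d: "d < n" if "2 * d \<le> n" using that d_ge by linarith
  have ndvd: "d < n" if "\<not> d dvd n" using that d_le by (cases "d = n") auto
  have ge2d': "even r \<or> d < n" if "even r \<or> 2 * d \<le> n"
    using that ge2d by blast
  show ?thesis
    by (intro conjI impI; (elim conjE)?)
      (rule a_small a_large a_upper_real b1 b2 b2' b3
        upper[OF ge2d'] upper[OF disjI2[OF ndvd]]; assumption)+
qed

end
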